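(* Under the hard-cluster community model with parameters $(n,k,\tau)$, as $n\to\infty$, each of the following conditions implies strong detection by the community interval test with parameters $(k,\tau)$: (i) $k=c\log n$ for a constant $c>0$ and $\tau\le e^{-2/c}$. (ii) $3/\epsilon<k\le n$ and $\tau\le\left(\frac{k}{ne}\right)^{\frac{2+\epsilon}{k-1}}$ for a fixed $\epsilon\in(0,1)$. (iii) $k=\omega(\log n)$ and $\tau\le1-\frac{2(1+\epsilon)}{k-1}\log\frac{ne}{k}$ for a fixed $\epsilon>0$. (iv) $3\le k\le n$ and $\tau=\left(\frac{k}{ne}\right)^{\frac{(1+\epsilon)k}{\binom k2-1}}$ for a fixed $\epsilon>0$. (v) $3/\epsilon<k=o(n)$ and $\tau=\left(\frac kn\right)^{\frac{2+\epsilon}{k-1}}$ for some fixed $\epsilon\in(0,1)$.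
   Context: Hard-cluster community model $(n,k,\tau)$, with $2\le k\le n$ an integer and $\tau\in(0,1)$ (both possibly depending on $n$): a symmetric array of angles $X=(X_{ij})_{1\le i<j\le n}$, $X_{ij}=X_{ji}\in[0,2\pi)$, is observed, viewed as labels $X_e$ on the edges $e=\{i,j\}$ of the complete graph on $[n]$. For $C\subset[n]$, $E(C)$ is the set of edges with both endpoints in $C$. Under $H_0$ (law $\mathbb{Q}$) the $X_{ij}$, $i<j$, are i.i.d. uniform on $[0,2\pi)$. Under $H_1$ (law $\mathbb{P}$), a community $C^*\subset[n]$ is drawn uniformly at random among subsets of size $k$, a phase $\Theta^*$ is drawn independently and uniformly on $[0,2\pi)$, and given $(C^*,\Theta^* )$ the labels are independent with $X_e$ uniform on the arc $[\Theta^*,\Theta^*+2\pi\tau]$ (mod $2\pi$) for $e\in E(C^* )$ and $X_e$ uniform on $[0,2\pi)$ for all other edges. All arcs are understood modulo $2\pi$. $k=c\log n$ is understood up to rounding to an integer; $k=\omega(\log n)$ means $k/\log n\to\infty$; $\log$ is the natural logarithm. A test is a measurable function $\phi$ of the data with values in $\{0,1\}$ ($1$ means reject $H_0$). $p_{\mathrm{fa}}(\phi)=\mathbb{Q}\{\phi(X)=1\}$ and $p_{\mathrm{miss}}(\phi)=\mathbb{P}\{\phi(X)=0\}$. A sequence of tests achieves strong detection if $p_{\mathrm{fa}}\to0$ and $p_{\mathrm{miss}}\to0$. Community interval test with parameters $(k,\tau)$: reject $H_0$ if and only if there exist $\theta\in[0,2\pi)$ and $C\subset[n]$ with $|C|=k$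 such that $X_e\in[\theta,\theta+2\pi\tau]$ for all $e\in E(C)$. *)

theory Defs
  imports "HOL-Probability.Probability" "HOL-Library.Landau_Symbols"
begin

definition edges :: "nat set \<Rightarrow> nat set set" where
  "edges C = {e. e \<subseteq> C \<and> card e = 2}"

definition angle_measure :: "real measure" where
  "angle_measure = restrict_space lborel {0..<2 * pi}"

text \<open>The closed arc \<open>[\<theta>, \<theta> + l]\<close> modulo \<open>2\<pi>\<close>, as a set of representatives in \<open>[0, 2\<pi>)\<close>.\<close>

definition angle_arc :: "real \<Rightarrow> real \<Rightarrow> real set" where
  "angle_arc \<theta> l = {x \<in> {0..<2 * pi}. \<exists>t\<in>{0..l}. \<exists>m::int. x = \<theta> + t + 2 * pi * of_int m}"

definition uniform_angle :: "real set \<Rightarrow> real measure" where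
  "uniform_angle A = uniform_measure angle_measure A"

text \<open>A symmetric array \<open>(X\<^sub>i\<^sub>j)\<close> is a function on the edges of the complete graph on \<open>{1..n}\<close>.
  The product measure below is only used for its underlying measurable space.\<close>

definition data_space :: "nat \<Rightarrow> (nat set \<Rightarrow> real) measure" where
  "data_space n = Pi\<^sub>M (edges {1..n}) (\<lambda>_. angle_measure)"

definition null_law :: "nat \<Rightarrow> (nat set \<Rightarrow> real) measure" where
  "null_law n = Pi\<^sub>M (edges {1..n}) (\<lambda>_. uniform_angle {0..<2 * pi})"

definition conditional_law ::
    "nat \<Rightarrow> real \<Rightarrow> nat set \<Rightarrow> real \<Rightarrow> (nat set \<Rightarrow> real) measure" where
  "conditional_law n \<tau> C \<theta> =
     Pi\<^sub>M (edges {1..n})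
       (\<lambda>e. if e \<in> edges C then uniform_angle (angle_arc \<theta> (2 * pi * \<tau>))
            else uniform_angle {0..<2 * pi})"

definition planted_law :: "nat \<Rightarrow> nat \<Rightarrow> real \<Rightarrow> (nat set \<Rightarrow> real) measure" where
  "planted_law n k \<tau> =
     measure_pmf (pmf_of_set {C. C \<subseteq> {1..n} \<and> card C = k}) \<bind> (\<lambda>C.
       uniform_angle {0..<2 * pi} \<bind> (\<lambda>\<theta>. conditional_law n \<tau> C \<theta>))"

definition is_test :: "nat \<Rightarrow> ((nat set \<Rightarrow> real) \<Rightarrow> nat) \<Rightarrow> bool" where
  "is_test n \<phi> \<longleftrightarrow> \<phi> \<in> measurable (data_space n) (count_space {0, 1})"

definition p_fa :: "nat \<Rightarrow> ((nat set \<Rightarrow> real) \<Rightarrow> nat) \<Rightarrow> real" where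
  "p_fa n \<phi> = measure (null_law n) {x \<in> space (data_space n). \<phi> x = 1}"

definition p_miss :: "nat \<Rightarrow> nat \<Rightarrow> real \<Rightarrow> ((nat set \<Rightarrow> real) \<Rightarrow> nat) \<Rightarrow> real" where
  "p_miss n k \<tau> \<phi> = measure (planted_law n k \<tau>) {x \<in> space (data_space n). \<phi> x = 0}"

definition strong_detection ::
    "(nat \<Rightarrow> nat) \<Rightarrow> (nat \<Rightarrow> real) \<Rightarrow> (nat \<Rightarrow> (nat set \<Rightarrow> real) \<Rightarrow> nat) \<Rightarrow> bool" where
  "strong_detection k \<tau> \<phi> \<longleftrightarrow>
     (\<forall>n. is_test n (\<phi> n)) \<and>
     (\<lambda>n. p_fa n (\<phi> n)) \<longlonglongrightarrow> 0 \<and>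
     (\<lambda>n. p_miss n (k n) (\<tau> n) (\<phi> n)) \<longlonglongrightarrow> 0"

definition community_interval_test ::
    "nat \<Rightarrow> nat \<Rightarrow> real \<Rightarrow> (nat set \<Rightarrow> real) \<Rightarrow> nat" where
  "community_interval_test n k \<tau> x =
     (if \<exists>\<theta>\<in>{0..<2 * pi}. \<exists>C. C \<subseteq> {1..n} \<and> card C = k \<and>
           (\<forall>e\<in>edges C. x e \<in> angle_arc \<theta> (2 * pi * \<tau>))
      then 1 else 0)"

end

theory Submission
  imports Defs "HOL-Real_Asymp.Real_Asymp"
begin

text \<open>
  The test never misses: under the planted law all labels inside the community lie, almost surely,
  on the planted arc, so the pair \<open>(\<Theta>\<^sup>*, C\<^sup>*)\<close> itself makes the test reject. Hence \<open>p_miss\<close> vanishes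
  (\<open>p_miss_zero\<close>), and the whole content is a bound on the false alarm probability.

  Under the null law, fix a set \<open>C\<close> of size \<open>k\<close> and write \<open>m = k choose 2\<close> for its number of
  edges. If the labels of \<open>C\<close> share an arc of length \<open>2\<pi>\<tau>\<close>, slide the arc forward until it starts
  at the first label it contains: the uncountable family of arcs is thereby replaced by the \<open>m\<close>
  arcs that start at a label (\<open>arc_anchored_at_label\<close>). Given the anchor, each of the other \<open>m - 1\<close>
  labels hits the arc with probability \<open>\<tau>\<close>, independently. A union bound over \<open>C\<close> and over the
  anchor gives \<open>p_fa \<le> (n choose k) * m * \<tau> ^ (m - 1)\<close> (\<open>p_fa_le\<close>). The same reduction to
  finitely many arcs shows that the test is measurable.

  The rest is calculus. Let \<open>L = ln (n e / k)\<close>. As \<open>n choose k \<le> exp (k L)\<close> and \<open>m \<le> k\<^sup>2\<close>,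
  strong detection holds as soon as \<open>k L + (m - 1) ln \<tau> + 2 ln k\<close> tends to \<open>-\<infinity>\<close>. The number of
  edges enters through \<open>2 (m - 1) / (k - 1) = k - 2 / (k - 1)\<close>: taking \<open>ln \<tau>\<close> slightly below
  \<open>- 2 L / (k - 1)\<close> balances the entropy term \<open>k L\<close>, and the slack \<open>\<epsilon>\<close> leaves an exponent of at most
  \<open>- \<delta> k L\<close> with \<open>\<delta> > 0\<close>. This beats \<open>2 ln k\<close> uniformly in \<open>k\<close>, because \<open>k L\<close> is at least \<open>k\<close>
  and also at least \<open>1 + ln n\<close> (\<open>filterlim_fa_exponent\<close>); so neither bounded nor growing \<open>k\<close> needs
  separate treatment. Only the regime \<open>k = c log n\<close> has no such slack; there the leading terms
  \<open>k\<^sup>2 / c\<close> cancel and the decay comes from the \<open>- k ln k\<close> contained in \<open>k L\<close>.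
\<close>

section \<open>Arcs and the uniform law on the circle\<close>

lemma space_angle [simp]: "space angle_measure = {0..<2 * pi}"
  by (simp add: angle_measure_def space_restrict_space)

lemma measurable_angle_borel: "f \<in> measurable N angle_measure \<Longrightarrow> f \<in> borel_measurable N"
  unfolding angle_measure_def measurable_restrict_space2_iff by simp

text \<open>
  Eliminating the real parameter \<open>t\<close> leaves a quantifier over the integers only, which makes
  arc membership visibly measurable, also jointly in the point and the start of the arc.
\<close>

lemma mem_angle_arc_iff:
  "x \<in> angle_arc \<theta> l \<longleftrightarrow> 0 \<le> x \<and> x < 2 * pi \<and> (\<exists>m::int. 0 \<le> x - \<theta> - 2 * pi * of_int m \<and> x - \<theta> - 2 * pi * of_int m \<le> l)"
proof -
  have "(\<exists>t\<in>{0..l}. x = \<theta> + t + 2 * pi * of_int m) \<longleftrightarrow>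
      0 \<le> x - \<theta> - 2 * pi * of_int m \<and> x - \<theta> - 2 * pi * of_int m \<le> l" for m :: int
    by (rule iffI, force, rule bexI[where x = "x - \<theta> - 2 * pi * of_int m"]) auto
  then show ?thesis unfolding angle_arc_def by (simp only: mem_Collect_eq atLeastLessThan_iff) blast
qed

lemma pred_mem_angle_arc:
  assumes "f \<in> measurable N angle_measure" "g \<in> measurable N angle_measure"
  shows "Measurable.pred N (\<lambda>x. g x \<in> angle_arc (f x) l)"
proof -
  note [measurable] = assms[THEN measurable_angle_borel]
  show ?thesis unfolding mem_angle_arc_iff by measurable
qed

text \<open>
  An arc shorter than the full circle wraps around at most once, so only the shifts by \<open>0\<close> and
  \<open>- 2\<pi>\<close> can bring a point of \<open>[\<theta>, \<theta> + l]\<close> back to \<open>[0, 2\<pi>)\<close>.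
\<close>

lemma angle_arc_eq:
  assumes "\<theta> \<in> {0..<2 * pi}" "0 \<le> l" "l < 2 * pi"
  shows "angle_arc \<theta> l =
    (if \<theta> + l < 2 * pi then {\<theta>..\<theta> + l} else {0..\<theta> + l - 2 * pi} \<union> {\<theta>..<2 * pi})"
proof -
  have *: "(\<exists>m::int. 0 \<le> x - \<theta> - 2 * pi * of_int m \<and> x - \<theta> - 2 * pi * of_int m \<le> l) \<longleftrightarrow>
     (0 \<le> x - \<theta> \<and> x - \<theta> \<le> l) \<or> (0 \<le> x - \<theta> + 2 * pi \<and> x - \<theta> + 2 * pi \<le> l)" (is "?L \<longleftrightarrow> ?R")
    if x: "0 \<le> x" "x < 2 * pi" for x
  proof
    assume ?L
    then obtain m :: int where m: "0 \<le> x - \<theta> - 2 * pi * of_int m" "x - \<theta> - 2 * pi * of_int m \<le> l" by blast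
    have "2 * pi * of_int m < 2 * pi * 1" using m x assms unfolding atLeastLessThan_iff by linarith
    then have "of_int m < (1::real)" using pi_gt_zero by (subst (asm) mult_less_cancel_left_pos) auto
    then have m1: "m \<le> 0" by linarith
    have "2 * pi * (-2) < 2 * pi * of_int m" using m x assms unfolding atLeastLessThan_iff by linarith
    then have "-2 < (of_int m :: real)" using pi_gt_zero by (subst (asm) mult_less_cancel_left_pos) auto
    then have "m \<ge> -1" by linarith
    with m1 have "m = 0 \<or> m = -1" by linarith
    then show ?R using m by auto
  next
    assume ?R
    then show ?L
    proof
      assume "0 \<le> x - \<theta> \<and> x - \<theta> \<le> l" then show ?L by (intro exI[of _ 0]) simp
    next
      assume "0 \<le> x - \<theta> + 2 * pi \<and> x - \<theta> + 2 * pi \<le> l" then show ?L by (intro exI[of _ "-1"]) simp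
    qed
  qed
  show ?thesis
  proof (rule set_eqI)
    fix x
    have "x \<in> angle_arc \<theta> l \<longleftrightarrow> 0 \<le> x \<and> x < 2 * pi \<and> ((0 \<le> x - \<theta> \<and> x - \<theta> \<le> l) \<or> (0 \<le> x - \<theta> + 2 * pi \<and> x - \<theta> + 2 * pi \<le> l))"
      unfolding mem_angle_arc_iff using * by blast
    also have "\<dots> \<longleftrightarrow> x \<in> (if \<theta> + l < 2 * pi then {\<theta>..\<theta> + l} else {0..\<theta> + l - 2 * pi} \<union> {\<theta>..<2 * pi})"
      using assms by auto
    finally show "x \<in> angle_arc \<theta> l \<longleftrightarrow> x \<in> (if \<theta> + l < 2 * pi then {\<theta>..\<theta> + l} else {0..\<theta> + l - 2 * pi} \<union> {\<theta>..<2 * pi})" .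
  qed
qed

lemma emeasure_angle: "A \<subseteq> {0..<2 * pi} \<Longrightarrow> emeasure angle_measure A = emeasure lborel A"
  unfolding angle_measure_def by (rule emeasure_restrict_space) auto

lemma angle_arc_subset: "angle_arc \<theta> l \<subseteq> {0..<2 * pi}"
  unfolding angle_arc_def by auto

lemma emeasure_angle_arc:
  assumes "\<theta> \<in> {0..<2 * pi}" "0 \<le> l" "l < 2 * pi"
  shows "emeasure angle_measure (angle_arc \<theta> l) = ennreal l"
proof (cases "\<theta> + l < 2 * pi")
  case True
  have "emeasure angle_measure (angle_arc \<theta> l) = emeasure lborel {\<theta>..\<theta> + l}"
    unfolding emeasure_angle[OF angle_arc_subset] using True assms by (simp add: angle_arc_eq)
  then show ?thesis using assms by simp
next
  case False
  have "emeasure lborel ({0..\<theta> + l - 2 * pi} \<union> {\<theta>..<2 * pi}) =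
     emeasure lborel {0..\<theta> + l - 2 * pi} + emeasure lborel {\<theta>..<2 * pi}"
    using assms by (intro plus_emeasure[symmetric]) auto
  also have "\<dots> = ennreal l"
    using assms False by (simp add: ennreal_plus[symmetric] del: ennreal_plus)
  finally show ?thesis unfolding emeasure_angle[OF angle_arc_subset] using assms False by (simp add: angle_arc_eq)
qed

lemma sets_angle_arc: "\<theta> \<in> {0..<2 * pi} \<Longrightarrow> angle_arc \<theta> l \<in> sets angle_measure"
proof -
  assume t: "\<theta> \<in> {0..<2 * pi}"
  have "Measurable.pred angle_measure (\<lambda>x. x \<in> angle_arc \<theta> l)"
    using t by (intro pred_mem_angle_arc) auto
  then have "{x \<in> space angle_measure. x \<in> angle_arc \<theta> l} \<in> sets angle_measure" by (rule predE)
  also have "{x \<in> space angle_measure. x \<in> angle_arc \<theta> l} = angle_arc \<theta> l"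
    using angle_arc_subset by fastforce
  finally show ?thesis .
qed

lemma emeasure_angle_full: "emeasure angle_measure {0..<2 * pi} = ennreal (2 * pi)"
  by (simp add: emeasure_angle)

lemma space_uniform_angle [simp]: "space (uniform_angle A) = {0..<2 * pi}"
  and sets_uniform_angle [simp, measurable_cong]: "sets (uniform_angle A) = sets angle_measure"
  by (simp_all add: uniform_angle_def)

lemma prob_space_uniform_angle: "prob_space (uniform_angle {0..<2 * pi})"
  unfolding uniform_angle_def
  by (rule prob_space_uniform_measure) (simp_all add: emeasure_angle_full)

lemma prob_space_uniform_angle_arc:
  assumes "\<theta> \<in> {0..<2 * pi}" "0 < \<tau>" "\<tau> < 1"
  shows "prob_space (uniform_angle (angle_arc \<theta> (2 * pi * \<tau>)))"
  unfolding uniform_angle_def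
  using assms by (intro prob_space_uniform_measure) (simp_all add: emeasure_angle_arc)

lemma emeasure_uniform_arc:
  assumes "\<theta> \<in> {0..<2 * pi}" "0 < \<tau>" "\<tau> < 1"
  shows "emeasure (uniform_angle {0..<2 * pi}) (angle_arc \<theta> (2 * pi * \<tau>)) = ennreal \<tau>"
proof -
  have "{0..<2 * pi} \<inter> angle_arc \<theta> (2 * pi * \<tau>) = angle_arc \<theta> (2 * pi * \<tau>)"
    using angle_arc_subset by blast
  then have "emeasure (uniform_angle {0..<2 * pi}) (angle_arc \<theta> (2 * pi * \<tau>)) =
    ennreal (2 * pi * \<tau>) / ennreal (2 * pi)"
    unfolding uniform_angle_def using assms sets_angle_arc[of \<theta> "2*pi*\<tau>"] sets.top[of angle_measure]
    by (simp add: emeasure_angle_arc emeasure_angle_full)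
  also have "\<dots> = ennreal \<tau>" using assms by (simp add: divide_ennreal)
  finally show ?thesis .
qed

section \<open>The rejection region as a finite union of anchored arc events\<close>

lemma finite_edges: "finite C \<Longrightarrow> finite (edges C)"
  unfolding edges_def by simp

lemma edges_mono: "C \<subseteq> D \<Longrightarrow> edges C \<subseteq> edges D"
  unfolding edges_def by auto

lemma card_edges: "finite C \<Longrightarrow> card (edges C) = card C choose 2"
  unfolding edges_def by (simp add: n_subsets)

lemma space_data: "x \<in> space (data_space n) \<Longrightarrow> e \<in> edges {1..n} \<Longrightarrow> x e \<in> {0..<2 * pi}"
  unfolding data_space_def by (auto simp: space_PiM)

text \<open>
  A common arc may start at the label that comes first on it, since the others follow within the
  same length. This exchanges an uncountable choice of \<open>\<theta>\<close> for a choice among finitely many labels.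
\<close>

lemma arc_anchored_at_label:
  assumes "finite E" "E \<noteq> {}" and x: "\<And>e. e \<in> E \<Longrightarrow> x e \<in> {0..<2 * pi}"
  shows "(\<exists>\<theta>\<in>{0..<2 * pi}. \<forall>e\<in>E. x e \<in> angle_arc \<theta> l) \<longleftrightarrow>
    (\<exists>a\<in>E. \<forall>e\<in>E. x e \<in> angle_arc (x a) l)"
proof
  assume "\<exists>\<theta>\<in>{0..<2 * pi}. \<forall>e\<in>E. x e \<in> angle_arc \<theta> l"
  then obtain \<theta> where "\<forall>e\<in>E. \<exists>t\<in>{0..l}. \<exists>m::int. x e = \<theta> + t + 2 * pi * of_int m"
    unfolding angle_arc_def by blast
  then obtain t m where t: "\<And>e. e \<in> E \<Longrightarrow> t e \<in> {0..l}"
    and m: "\<And>e. e \<in> E \<Longrightarrow> x e = \<theta> + t e + 2 * pi * of_int (m e :: int)"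
    by metis
  \<comment> \<open>the label with the smallest offset from the start of the arc\<close>
  obtain a where a: "a \<in> E" "\<And>e. e \<in> E \<Longrightarrow> t a \<le> t e"
    using ex_is_arg_min_if_finite[OF assms(1,2), of t] unfolding is_arg_min_linorder by blast
  have "x e \<in> angle_arc (x a) l" if e: "e \<in> E" for e
  proof -
    have "x e - x a - 2 * pi * of_int (m e - m a) = t e - t a"
      using m[OF e] m[OF a(1)] by (simp add: algebra_simps)
    moreover have "0 \<le> t e - t a" "t e - t a \<le> l" using a e t[OF e] t[OF a(1)] by auto
    ultimately show ?thesis unfolding mem_angle_arc_iff using x[OF e] by (metis atLeastLessThan_iff)
  qed
  with a show "\<exists>a\<in>E. \<forall>e\<in>E. x e \<in> angle_arc (x a) l" by blast
next
  assume "\<exists>a\<in>E. \<forall>e\<in>E. x e \<in> angle_arc (x a) l"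
  then show "\<exists>\<theta>\<in>{0..<2 * pi}. \<forall>e\<in>E. x e \<in> angle_arc \<theta> l" using x by blast
qed

definition arc_event :: "nat \<Rightarrow> real \<Rightarrow> nat set \<Rightarrow> nat set \<Rightarrow> (nat set \<Rightarrow> real) set" where
  "arc_event n \<tau> C a =
     {x \<in> space (data_space n). \<forall>e\<in>edges C. x e \<in> angle_arc (x a) (2 * pi * \<tau>)}"

lemma sets_arc_event:
  assumes "C \<subseteq> {1..n}" "a \<in> edges C"
  shows "arc_event n \<tau> C a \<in> sets (data_space n)"
proof -
  have fin: "finite (edges C)" using assms finite_subset[of C "{1..n}"] by (auto intro: finite_edges)
  have "Measurable.pred (data_space n) (\<lambda>x. x e \<in> angle_arc (x a) (2 * pi * \<tau>))" if "e \<in> edges C" for e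
    unfolding data_space_def
    using that assms(2) edges_mono[OF assms(1)] by (intro pred_mem_angle_arc measurable_component_singleton) auto
  then show ?thesis unfolding arc_event_def using fin by (intro sets.sets_Collect_finite_All) (auto dest: predE)
qed

lemma edges_nonempty: "2 \<le> card C \<Longrightarrow> edges C \<noteq> {}"
proof -
  assume "2 \<le> card C"
  moreover from this have "finite C" by (intro card_ge_0_finite) simp
  ultimately have "card (edges C) \<noteq> 0" by (simp add: card_edges binomial_eq_0_iff)
  then show ?thesis by auto
qed

lemma edges_empty: "finite C \<Longrightarrow> card C < 2 \<Longrightarrow> edges C = {}"
  using card_edges[of C] finite_edges[of C] by (simp add: binomial_eq_0)

lemma rejection_region:
  assumes "2 \<le> k"
  shows "{x \<in> space (data_space n). community_interval_test n k \<tau> x = 1} =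
    (\<Union>C\<in>{C. C \<subseteq> {1..n} \<and> card C = k}. \<Union>a\<in>edges C. arc_event n \<tau> C a)"
proof -
  let ?anchored = "\<lambda>C x. \<exists>a\<in>edges C. \<forall>e\<in>edges C. x e \<in> angle_arc (x a) (2 * pi * \<tau>)"
  have anchored: "(\<exists>\<theta>\<in>{0..<2 * pi}. \<forall>e\<in>edges C. x e \<in> angle_arc \<theta> (2 * pi * \<tau>)) \<longleftrightarrow> ?anchored C x"
    if "C \<subseteq> {1..n}" "card C = k" "x \<in> space (data_space n)" for C x
    using that assms edges_mono[OF that(1)] finite_subset[OF that(1)] space_data[OF that(3)]
    by (intro arc_anchored_at_label finite_edges edges_nonempty) auto
  have "community_interval_test n k \<tau> x = 1 \<longleftrightarrow>
      (\<exists>C. C \<subseteq> {1..n} \<and> card C = k \<and> ?anchored C x)"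
    if x: "x \<in> space (data_space n)" for x
  proof -
    have "community_interval_test n k \<tau> x = 1 \<longleftrightarrow>
        (\<exists>C. C \<subseteq> {1..n} \<and> card C = k \<and>
          (\<exists>\<theta>\<in>{0..<2 * pi}. \<forall>e\<in>edges C. x e \<in> angle_arc \<theta> (2 * pi * \<tau>)))"
      unfolding community_interval_test_def by (simp only: if_split_eq1 zero_neq_one) blast
    also have "\<dots> \<longleftrightarrow> (\<exists>C. C \<subseteq> {1..n} \<and> card C = k \<and> ?anchored C x)"
      using anchored x by (intro ex_cong1 conj_cong refl)
    finally show ?thesis .
  qed
  then show ?thesis
    unfolding arc_event_def by blast
qed

text \<open>
  For \<open>k \<ge> 2\<close> the rejection region is a finite union of measurable events. For \<open>k < 2\<close> there are no
  edges to constrain and the test does not depend on the data.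
\<close>

lemma is_test_community_interval: "is_test n (community_interval_test n k \<tau>)"
proof (cases "2 \<le> k")
  case True
  have "finite {C. C \<subseteq> {1..n} \<and> card C = k}" by simp
  then have 1: "{x \<in> space (data_space n). community_interval_test n k \<tau> x = 1} \<in> sets (data_space n)"
    unfolding rejection_region[OF True]
    by (intro sets.finite_UN finite_edges sets_arc_event) (auto dest: finite_subset[OF _ finite_atLeastAtMost])
  have "community_interval_test n k \<tau> = (\<lambda>x. if community_interval_test n k \<tau> x = 1 then 1 else 0)"
    by (auto simp: community_interval_test_def)
  then show ?thesis unfolding is_test_def
    using 1 by (subst \<open>_ = (\<lambda>x. _)\<close>) (intro measurable_If, auto)
next
  case False
  have "edges C = {}" if "C \<subseteq> {1..n}" "card C = k" for C
    using that False edges_empty finite_subset[of C "{1..n}"] by auto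
  then have "community_interval_test n k \<tau> =
      (\<lambda>_. if \<exists>\<theta>\<in>{0..<2 * pi}. \<exists>C. C \<subseteq> {1..n} \<and> card C = k then 1 else 0)"
    unfolding community_interval_test_def by (intro ext if_cong refl bex_cong ex_cong1) auto
  then show ?thesis unfolding is_test_def by simp
qed

section \<open>False alarm probability\<close>

lemma sets_null_law: "sets (null_law n) = sets (data_space n)"
  unfolding null_law_def data_space_def by (intro sets_PiM_cong) simp_all

lemma space_data_space: "space (data_space n) = (\<Pi>\<^sub>E e\<in>edges {1..n}. {0..<2 * pi})"
  unfolding data_space_def by (simp add: space_PiM)

text \<open>
  Condition on the label \<open>y\<close> of the anchor \<open>a\<close>. What remains is a product event for the other
  edges: an arc of probability \<open>\<tau>\<close> for each of the remaining edges of \<open>C\<close>, no constraint elsewhere.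
  The result does not depend on \<open>y\<close>, so integrating over \<open>y\<close> changes nothing.
\<close>

lemma null_prob_arc_event:
  assumes C: "C \<subseteq> {1..n}" and a: "a \<in> edges C" and \<tau>: "0 < \<tau>" "\<tau> < 1"
  shows "emeasure (null_law n) (arc_event n \<tau> C a) = ennreal (\<tau> ^ (card (edges C) - 1))"
proof -
  define U where "U = uniform_angle {0..<2 * pi}"
  define I where "I = edges {1..n} - {a}"
  define arcs where "arcs y = (\<Pi>\<^sub>E e\<in>I. if e \<in> edges C then angle_arc y (2 * pi * \<tau>) else {0..<2 * pi})" for y
  interpret prob_space U unfolding U_def by (rule prob_space_uniform_angle)
  interpret product_sigma_finite "\<lambda>_ :: nat set. U" by standard
  have fin: "finite I" unfolding I_def by (simp add: finite_edges)
  have sub: "edges C \<subseteq> edges {1..n}" by (rule edges_mono[OF C])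
  then have I: "insert a I = edges {1..n}" "a \<notin> I" "edges C - {a} = I \<inter> edges C" 
    using a unfolding I_def by auto
  have null: "null_law n = Pi\<^sub>M (insert a I) (\<lambda>_. U)"
    unfolding null_law_def U_def I(1) ..
  have meas: "arc_event n \<tau> C a \<in> sets (Pi\<^sub>M (insert a I) (\<lambda>_. U))"
    using sets_arc_event[OF C a] unfolding null[symmetric] sets_null_law .
  have full: "{0..<2 * pi} \<in> sets U" using sets.top[of U] unfolding U_def by simp
  have arc: "angle_arc y (2 * pi * \<tau>) \<in> sets U" if "y \<in> space U" for y
    using that sets_angle_arc unfolding U_def by simp
  \<comment> \<open>the section of the event at \<open>y\<close> is a product set; the anchor lies on its own arc\<close>
  have mem: "x(a := y) \<in> arc_event n \<tau> C a \<longleftrightarrow> x \<in> arcs y"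
    if x: "x \<in> space (Pi\<^sub>M I (\<lambda>_. U))" and y: "y \<in> space U" for x y
  proof -
    have y': "0 \<le> y" "y < 2 * pi" using y unfolding U_def by auto
    have xI: "x \<in> (\<Pi>\<^sub>E e\<in>I. {0..<2 * pi})" using x unfolding U_def by (simp add: space_PiM)
    have "x(a := y) \<in> space (data_space n)"
      unfolding space_data_space I(1)[symmetric] using xI y' I(2) by (auto simp: PiE_def extensional_def)
    moreover have "y \<in> angle_arc y (2 * pi * \<tau>)"
      unfolding mem_angle_arc_iff using y' \<tau> by (auto intro!: exI[of _ 0])
    ultimately have "x(a := y) \<in> arc_event n \<tau> C a \<longleftrightarrow>
        (\<forall>e\<in>edges C - {a}. x e \<in> angle_arc y (2 * pi * \<tau>))"
      unfolding arc_event_def by auto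
    also have "\<dots> \<longleftrightarrow> x \<in> arcs y"
      using xI unfolding arcs_def I(3) PiE_iff by (auto split: if_splits)
    finally show ?thesis .
  qed
  have arcs: "emeasure (Pi\<^sub>M I (\<lambda>_. U)) (arcs y) = ennreal (\<tau> ^ (card (edges C) - 1))"
    and arcs_sets: "arcs y \<in> sets (Pi\<^sub>M I (\<lambda>_. U))"
    if y: "y \<in> space U" for y
  proof -
    have "emeasure (Pi\<^sub>M I (\<lambda>_. U)) (arcs y) =
        (\<Prod>e\<in>I. emeasure U (if e \<in> edges C then angle_arc y (2 * pi * \<tau>) else {0..<2 * pi}))"
      unfolding arcs_def using arc[OF y] full by (intro emeasure_PiM fin) auto
    also have "\<dots> = (\<Prod>e\<in>I. if e \<in> edges C then ennreal \<tau> else 1)"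
      using y \<tau> emeasure_space_1 unfolding U_def by (intro prod.cong refl) (auto simp: emeasure_uniform_arc)
    also have "\<dots> = (\<Prod>e\<in>I \<inter> edges C. ennreal \<tau>)"
      by (rule prod.inter_restrict[OF fin, symmetric])
    also have "\<dots> = ennreal \<tau> ^ card (edges C - {a})"
      unfolding I(3) by simp
    also have "\<dots> = ennreal (\<tau> ^ (card (edges C) - 1))"
      using a \<tau> by (simp add: card_Diff_singleton ennreal_power)
    finally show "emeasure (Pi\<^sub>M I (\<lambda>_. U)) (arcs y) = ennreal (\<tau> ^ (card (edges C) - 1))" .
    show "arcs y \<in> sets (Pi\<^sub>M I (\<lambda>_. U))"
      unfolding arcs_def using arc[OF y] full by (intro sets_PiM_I_finite fin) auto
  qed
  have "emeasure (null_law n) (arc_event n \<tau> C a) =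
      (\<integral>\<^sup>+ z. indicator (arc_event n \<tau> C a) z \<partial>Pi\<^sub>M (insert a I) (\<lambda>_. U))"
    unfolding null using meas by simp
  also have "\<dots> = (\<integral>\<^sup>+ y. (\<integral>\<^sup>+ x. indicator (arc_event n \<tau> C a) (x(a := y)) \<partial>Pi\<^sub>M I (\<lambda>_. U)) \<partial>U)"
    using meas by (intro product_nn_integral_insert_rev fin I(2)) simp
  also have "\<dots> = (\<integral>\<^sup>+ y. (\<integral>\<^sup>+ x. indicator (arcs y) x \<partial>Pi\<^sub>M I (\<lambda>_. U)) \<partial>U)"
    using mem by (intro nn_integral_cong) (auto simp: indicator_def)
  also have "\<dots> = (\<integral>\<^sup>+ y. ennreal (\<tau> ^ (card (edges C) - 1)) \<partial>U)"
    using arcs arcs_sets by (intro nn_integral_cong) simp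
  also have "\<dots> = ennreal (\<tau> ^ (card (edges C) - 1))"
    by (simp add: emeasure_space_1)
  finally show ?thesis .
qed

text \<open>
  Union bound over the sets \<open>C\<close> and over the edge of \<open>C\<close> whose label anchors the arc.
\<close>

lemma p_fa_le:
  assumes k: "2 \<le> k" and \<tau>: "0 < \<tau>" "\<tau> < 1"
  shows "p_fa n (community_interval_test n k \<tau>) \<le>
    real (n choose k) * real (k choose 2) * \<tau> ^ ((k choose 2) - 1)"
proof -
  let ?S = "{C. C \<subseteq> {1..n} \<and> card C = k}"
  have S: "finite ?S" "card ?S = n choose k" using n_subsets[of "{1..n}" k] by auto
  have E: "finite (edges C)" "card (edges C) = k choose 2" if "C \<in> ?S" for C
    using that finite_subset[of C "{1..n}"] by (auto simp: finite_edges card_edges)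
  have meas: "arc_event n \<tau> C a \<in> sets (null_law n)" if "C \<in> ?S" "a \<in> edges C" for C a
    using that sets_arc_event unfolding sets_null_law by auto
  have "emeasure (null_law n) {x \<in> space (data_space n). community_interval_test n k \<tau> x = 1}
     \<le> (\<Sum>C\<in>?S. emeasure (null_law n) (\<Union>a\<in>edges C. arc_event n \<tau> C a))"
    unfolding rejection_region[OF k] using S E meas
    by (intro emeasure_subadditive_finite) (auto intro!: sets.finite_UN)
  also have "\<dots> \<le> (\<Sum>C\<in>?S. \<Sum>a\<in>edges C. emeasure (null_law n) (arc_event n \<tau> C a))"
    using E meas by (intro sum_mono emeasure_subadditive_finite) auto
  also have "\<dots> = (\<Sum>C\<in>?S. \<Sum>a\<in>edges C. ennreal (\<tau> ^ ((k choose 2) - 1)))"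
    using null_prob_arc_event[OF _ _ \<tau>] E(2) by (intro sum.cong refl) auto
  also have "\<dots> = of_nat (n choose k) * (of_nat (k choose 2) * ennreal (\<tau> ^ ((k choose 2) - 1)))"
    using E S by simp
  also have "\<dots> = ennreal (real (n choose k) * real (k choose 2) * \<tau> ^ ((k choose 2) - 1))"
    using \<tau> by (simp add: ennreal_of_nat_eq_real_of_nat ennreal_mult mult.assoc)
  finally show ?thesis
    unfolding p_fa_def measure_def using \<tau> by (intro enn2real_leI) auto
qed

section \<open>Missed detection probability\<close>

lemma prob_space_edge_law:
  assumes "\<theta> \<in> {0..<2 * pi}" "0 < \<tau>" "\<tau> < 1"
  shows "prob_space (if e \<in> edges C then uniform_angle (angle_arc \<theta> (2 * pi * \<tau>)) else uniform_angle {0..<2 * pi})"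
  using assms prob_space_uniform_angle prob_space_uniform_angle_arc by auto

text \<open>
  The numerator of the uniform law on the arc is the measure of a section of the jointly
  measurable set of pairs (start, point on the arc); the denominator, the length of the arc, is constant.
\<close>

lemma measurable_emeasure_uniform_arc:
  assumes \<tau>: "0 < \<tau>" "\<tau> < 1" and X: "X \<in> sets angle_measure"
  shows "(\<lambda>\<theta>. emeasure (uniform_angle (angle_arc \<theta> (2 * pi * \<tau>))) X) \<in> borel_measurable angle_measure"
proof -
  let ?l = "2 * pi * \<tau>"
  let ?Q = "{p \<in> space (angle_measure \<Otimes>\<^sub>M angle_measure). snd p \<in> angle_arc (fst p) ?l} \<inter> (space angle_measure \<times> X)"
  have fin: "finite_measure angle_measure"
    by (intro finite_measureI) (simp add: emeasure_angle_full)
  have "Measurable.pred (angle_measure \<Otimes>\<^sub>M angle_measure) (\<lambda>p. snd p \<in> angle_arc (fst p) ?l)"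
    by (intro pred_mem_angle_arc) auto
  then have "?Q \<in> sets (angle_measure \<Otimes>\<^sub>M angle_measure)"
    using X sets.top[of angle_measure] by (intro sets.Int predE pair_measureI) auto
  then have "(\<lambda>\<theta>. emeasure angle_measure (Pair \<theta> -` ?Q)) \<in> borel_measurable angle_measure"
    by (rule sigma_finite_measure.measurable_emeasure_Pair[OF finite_measure.axioms(1)[OF fin]])
  then have "(\<lambda>\<theta>. emeasure angle_measure (Pair \<theta> -` ?Q) / ennreal ?l) \<in> borel_measurable angle_measure"
    by (rule borel_measurable_divide_ennreal) simp
  also have "?this \<longleftrightarrow> ?thesis"
  proof (rule measurable_cong)
    fix \<theta> assume \<theta>: "\<theta> \<in> space angle_measure"
    have "Pair \<theta> -` ?Q = angle_arc \<theta> ?l \<inter> X"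
      using \<theta> angle_arc_subset by (fastforce simp: space_pair_measure)
    then show "emeasure angle_measure (Pair \<theta> -` ?Q) / ennreal ?l = emeasure (uniform_angle (angle_arc \<theta> ?l)) X"
      unfolding uniform_angle_def using \<theta> \<tau> X sets_angle_arc[of \<theta> ?l]
      by (simp add: emeasure_angle_arc)
  qed
  finally show ?thesis .
qed

text \<open>
  The mixture over \<open>\<theta>\<close> in the planted law is an integral of conditional probabilities once
  \<open>\<theta> \<mapsto> conditional_law n \<tau> C \<theta>\<close> is a kernel. On product sets, which generate the product space and are
  closed under intersection, it is a finite product of functions measurable in \<open>\<theta>\<close>.
\<close>

lemma measurable_conditional_law:
  assumes \<tau>: "0 < \<tau>" "\<tau> < 1"
  shows "conditional_law n \<tau> C \<in> measurable (uniform_angle {0..<2 * pi}) (subprob_algebra (data_space n))"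
proof -
  let ?K = "\<lambda>\<theta> e. if e \<in> edges C then uniform_angle (angle_arc \<theta> (2 * pi * \<tau>)) else uniform_angle {0..<2 * pi}"
  have "(\<lambda>\<theta>. Pi\<^sub>M (edges {1..n}) (?K \<theta>)) \<in> measurable angle_measure (prob_algebra (Pi\<^sub>M (edges {1..n}) (\<lambda>_. angle_measure)))"
  proof (rule measurable_prob_algebra_generated[OF sets_PiM Int_stable_prod_algebra prod_algebra_sets_into_space])
    fix \<theta> assume "\<theta> \<in> space angle_measure"
    then show "prob_space (Pi\<^sub>M (edges {1..n}) (?K \<theta>))"
      using \<tau> by (intro prob_space_PiM prob_space_edge_law) auto
    show "sets (Pi\<^sub>M (edges {1..n}) (?K \<theta>)) = sets (Pi\<^sub>M (edges {1..n}) (\<lambda>_. angle_measure))"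
      by (intro sets_PiM_cong) auto
  next
    fix A assume "A \<in> prod_algebra (edges {1..n}) (\<lambda>_. angle_measure)"
    then obtain X where A: "A = Pi\<^sub>E (edges {1..n}) X" and X: "X \<in> edges {1..n} \<rightarrow> sets angle_measure"
      by (rule prod_algebraE_all)
    have "(\<lambda>\<theta>. \<Prod>e\<in>edges {1..n}. emeasure (?K \<theta> e) (X e)) \<in> borel_measurable angle_measure"
    proof (rule borel_measurable_prod_ennreal)
      fix e assume "e \<in> edges {1..n}"
      then show "(\<lambda>\<theta>. emeasure (?K \<theta> e) (X e)) \<in> borel_measurable angle_measure"
        using X measurable_emeasure_uniform_arc[OF \<tau>] by (cases "e \<in> edges C") auto
    qed
    also have "?this \<longleftrightarrow> (\<lambda>\<theta>. emeasure (Pi\<^sub>M (edges {1..n}) (?K \<theta>)) A) \<in> borel_measurable angle_measure"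
    proof (rule measurable_cong)
      fix \<theta> assume "\<theta> \<in> space angle_measure"
      then have "prob_space (?K \<theta> e)" for e
        using \<tau> by (intro prob_space_edge_law) auto
      then interpret product_sigma_finite "?K \<theta>"
        by (intro product_sigma_finite.intro prob_space_imp_sigma_finite)
      show "(\<Prod>e\<in>edges {1..n}. emeasure (?K \<theta> e) (X e)) = emeasure (Pi\<^sub>M (edges {1..n}) (?K \<theta>)) A"
        unfolding A using X by (intro emeasure_PiM[symmetric] finite_edges) auto
    qed
    finally show "(\<lambda>\<theta>. emeasure (Pi\<^sub>M (edges {1..n}) (?K \<theta>)) A) \<in> borel_measurable angle_measure" .
  qed
  then have "conditional_law n \<tau> C \<in> measurable angle_measure (subprob_algebra (data_space n))"
    unfolding conditional_law_def[abs_def] data_space_def by (rule measurable_prob_algebraD)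
  then show ?thesis by (simp cong: measurable_cong_sets)
qed

text \<open>
  Almost surely every label inside \<open>C\<close> lies on the planted arc, so \<open>\<theta>\<close> and \<open>C\<close> witness rejection.
\<close>

lemma conditional_miss_zero:
  assumes C: "C \<subseteq> {1..n}" "card C = k" and \<theta>: "\<theta> \<in> {0..<2 * pi}" and \<tau>: "0 < \<tau>" "\<tau> < 1"
  shows "emeasure (conditional_law n \<tau> C \<theta>) {x \<in> space (data_space n). community_interval_test n k \<tau> x = 0} = 0"
proof -
  let ?K = "\<lambda>e. if e \<in> edges C then uniform_angle (angle_arc \<theta> (2 * pi * \<tau>)) else uniform_angle {0..<2 * pi}"
  have "AE x in conditional_law n \<tau> C \<theta>. x e \<in> angle_arc \<theta> (2 * pi * \<tau>)" if e: "e \<in> edges C" for e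
    unfolding conditional_law_def
  proof (rule AE_PiM_component[of "edges {1..n}" ?K])
    show "prob_space (?K i)" for i using \<theta> \<tau> by (rule prob_space_edge_law)
    show "e \<in> edges {1..n}" using e edges_mono[OF C(1)] by blast
    show "AE y in ?K e. y \<in> angle_arc \<theta> (2 * pi * \<tau>)"
      using e sets_angle_arc[OF \<theta>] unfolding uniform_angle_def
      by (auto intro!: AE_uniform_measureI)
  qed
  moreover have "finite (edges C)" using C finite_subset[of C "{1..n}"] by (auto intro: finite_edges)
  ultimately have "AE x in conditional_law n \<tau> C \<theta>. \<forall>e\<in>edges C. x e \<in> angle_arc \<theta> (2 * pi * \<tau>)"
    by (simp add: AE_finite_all)
  then have "AE x in conditional_law n \<tau> C \<theta>. community_interval_test n k \<tau> x \<noteq> 0"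
  proof eventually_elim
    case (elim x)
    then have "community_interval_test n k \<tau> x = 1"
      using C \<theta> unfolding community_interval_test_def by (intro if_P) blast
    then show ?case by simp
  qed
  moreover have "space (conditional_law n \<tau> C \<theta>) = space (data_space n)"
    unfolding conditional_law_def data_space_def space_PiM by (intro PiE_cong) simp
  ultimately show ?thesis by (metis (no_types) emeasure_eq_0_AE)
qed

lemma p_miss_zero:
  assumes k: "k \<le> n" and \<tau>: "0 < \<tau>" "\<tau> < 1"
  shows "p_miss n k \<tau> (community_interval_test n k \<tau>) = 0"
proof -
  let ?A = "{x \<in> space (data_space n). community_interval_test n k \<tau> x = 0}"
  let ?S = "{C. C \<subseteq> {1..n} \<and> card C = k}"
  let ?U = "uniform_angle {0..<2 * pi}"
  note kernel = measurable_conditional_law[OF \<tau>]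
  have U: "space ?U \<noteq> {}" by simp
  have A: "?A \<in> sets (data_space n)"
    using is_test_community_interval[of n k \<tau>] unfolding is_test_def by measurable
  have "?S \<noteq> {}" using obtain_subset_with_card_n[of k "{1..n}"] k by auto
  then have S: "set_pmf (pmf_of_set ?S) = ?S" by (intro set_pmf_of_set) auto
  have 0: "emeasure (?U \<bind> conditional_law n \<tau> C) ?A = 0" if "C \<in> ?S" for C
  proof -
    have "emeasure (?U \<bind> conditional_law n \<tau> C) ?A = (\<integral>\<^sup>+ \<theta>. emeasure (conditional_law n \<tau> C \<theta>) ?A \<partial>?U)"
      by (rule emeasure_bind[OF U kernel A])
    also have "\<dots> = (\<integral>\<^sup>+ \<theta>. 0 \<partial>?U)"
      using that conditional_miss_zero[OF _ _ _ \<tau>] by (intro nn_integral_cong) simp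
    finally show ?thesis by simp
  qed
  have "?U \<bind> conditional_law n \<tau> C \<in> space (subprob_algebra (data_space n))" for C
    unfolding space_subprob_algebra
    using subprob_space_bind[OF prob_space_imp_subprob_space[OF prob_space_uniform_angle] kernel[of n C]]
      sets_bind[of ?U "conditional_law n \<tau> C" "data_space n"] kernel[THEN sets_kernel] U by blast
  then have "emeasure (planted_law n k \<tau>) ?A =
      (\<integral>\<^sup>+ C. emeasure (?U \<bind> conditional_law n \<tau> C) ?A \<partial>measure_pmf (pmf_of_set ?S))"
    unfolding planted_law_def by (intro emeasure_bind[OF _ _ A]) auto
  also have "\<dots> = (\<integral>\<^sup>+ C. 0 \<partial>measure_pmf (pmf_of_set ?S))"
    using 0 S by (intro nn_integral_cong_AE) (simp add: AE_measure_pmf_iff)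
  finally show ?thesis unfolding p_miss_def measure_def by simp
qed

section \<open>Exponent of the union bound\<close>

lemma real_choose_two: "real (k choose 2) = real k * (real k - 1) / 2"
  by (induction k) (simp_all add: numeral_2_eq_2 field_simps)

text \<open>
  The left-hand side is one term of the exponential series.
\<close>

lemma power_div_fact_le_exp:
  fixes x :: real
  assumes "0 \<le> x"
  shows "x ^ k / fact k \<le> exp x"
proof -
  have s: "(\<lambda>n. x ^ n /\<^sub>R fact n) sums exp x" by (rule exp_converges)
  have "(\<Sum>n\<in>{k}. x ^ n /\<^sub>R fact n) \<le> (\<Sum>n. x ^ n /\<^sub>R fact n)"
    using s assms by (intro sum_le_suminf sums_summable) (auto intro: sums_summable)
  then show ?thesis using s by (simp add: sums_unique[symmetric] divide_inverse mult.commute)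
qed

text \<open>
  \<open>ln (n e / k)\<close>, the entropy per vertex: a set of size \<open>k\<close> can be chosen in at most
  \<open>exp (k * log_ratio n k)\<close> ways.
\<close>

definition log_ratio :: "nat \<Rightarrow> nat \<Rightarrow> real" where
  "log_ratio n k = ln (real n * exp 1 / real k)"

lemma log_ratio_eq: "0 < k \<Longrightarrow> 0 < n \<Longrightarrow> log_ratio n k = 1 + ln (real n) - ln (real k)"
  unfolding log_ratio_def by (simp add: ln_div ln_mult)

lemma log_ratio_ge_1:
  assumes "0 < k" "k \<le> n"
  shows "1 \<le> log_ratio n k"
  using assms by (subst log_ratio_eq) auto

text \<open>
  From \<open>n choose k \<le> n ^ k / k!\<close> and the weak Stirling bound \<open>k ^ k / k! \<le> e ^ k\<close>.
\<close>

lemma binomial_le_exp_log_ratio: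
  assumes "0 < k" "k \<le> n"
  shows "real (n choose k) \<le> exp (real k * log_ratio n k)"
proof -
  have "real ((n choose k) * fact k) \<le> real (n ^ k)"
    unfolding of_nat_le_iff by (rule binomial_fact_pow)
  then have "real (n choose k) \<le> real n ^ k / fact k"
    by (simp add: field_simps)
  also have "\<dots> = (real n / real k) ^ k * (real k ^ k / fact k)"
    using assms by (simp add: power_divide)
  also have "\<dots> \<le> (real n / real k) ^ k * exp (real k)"
    by (intro mult_left_mono power_div_fact_le_exp) auto
  also have "\<dots> = exp (log_ratio n k) ^ k"
    using assms unfolding log_ratio_def
    by (simp add: power_mult_distrib[symmetric] power_divide exp_of_nat_mult[of k "1::real", simplified])
  also have "\<dots> = exp (real k * log_ratio n k)"
    by (simp add: exp_of_nat_mult)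
  finally show ?thesis .
qed

text \<open>
  The function \<open>x \<mapsto> x (1 + ln n - ln x)\<close> increases on \<open>[1, n]\<close>, and its value at \<open>1\<close> is \<open>1 + ln n\<close>.
  The proof replaces monotonicity by \<open>ln k \<le> k - 1\<close>. This bound makes the exponents below diverge even
  when \<open>k\<close> stays bounded.
\<close>

lemma mult_log_ratio_ge:
  assumes "0 < k" "k \<le> n"
  shows "1 + ln (real n) \<le> real k * log_ratio n k"
proof -
  have "ln (real k) \<le> real k - 1" using assms by (intro ln_le_minus_one) simp
  moreover have "(real k - 1) * ln (real k) \<le> (real k - 1) * ln (real n)"
    using assms by (intro mult_left_mono) auto
  ultimately show ?thesis using assms by (simp add: log_ratio_eq algebra_simps)
qed

text \<open>
  Logarithm of the union bound up to its polynomial factor \<open>k choose 2\<close>: entropy of the choice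
  of \<open>C\<close> plus the cost of placing all labels but the anchor on the arc.
\<close>

definition fa_exponent :: "nat \<Rightarrow> nat \<Rightarrow> real \<Rightarrow> real" where
  "fa_exponent n k \<tau> = real k * log_ratio n k + (real (k choose 2) - 1) * ln \<tau>"

lemma union_bound_le_exp:
  assumes "2 \<le> k" "k \<le> n" "0 < \<tau>"
  shows "real (n choose k) * real (k choose 2) * \<tau> ^ ((k choose 2) - 1) \<le>
    exp (fa_exponent n k \<tau> + 2 * ln (real k))"
proof -
  have m: "1 \<le> k choose 2" using assms by (simp add: Suc_le_eq)
  have "real (k choose 2) \<le> real k ^ 2"
    unfolding real_choose_two using assms by (simp add: power2_eq_square field_simps)
  also have "\<dots> = exp (2 * ln (real k))"
    using assms by (simp add: exp_of_nat_mult[of 2, simplified])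
  finally have 1: "real (k choose 2) \<le> exp (2 * ln (real k))" .
  have 2: "\<tau> ^ ((k choose 2) - 1) = exp ((real (k choose 2) - 1) * ln \<tau>)"
    using m assms by (simp add: powr_realpow[symmetric] powr_def of_nat_diff)
  have "real (n choose k) * real (k choose 2) * \<tau> ^ ((k choose 2) - 1) \<le>
      exp (real k * log_ratio n k) * exp (2 * ln (real k)) * exp ((real (k choose 2) - 1) * ln \<tau>)"
    unfolding 2 using assms by (intro mult_mono 1 binomial_le_exp_log_ratio) auto
  also have "\<dots> = exp (fa_exponent n k \<tau> + 2 * ln (real k))"
    unfolding fa_exponent_def by (simp add: exp_add[symmetric] algebra_simps)
  finally show ?thesis .
qed

text \<open>
  Half of \<open>\<delta> k L\<close> pays for \<open>2 ln k\<close> through \<open>L \<ge> 1\<close>, the other half diverges through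
  \<open>k L \<ge> 1 + ln n\<close>.
\<close>

lemma filterlim_fa_exponent:
  assumes \<delta>: "\<delta> > 0"
    and k: "\<forall>\<^sub>F n in sequentially. 2 \<le> k n \<and> k n \<le> n"
    and F: "\<forall>\<^sub>F n in sequentially. fa_exponent n (k n) (\<tau> n) \<le> - \<delta> * (real (k n) * log_ratio n (k n))"
  shows "filterlim (\<lambda>n. fa_exponent n (k n) (\<tau> n) + 2 * ln (real (k n))) at_bot sequentially"
proof (rule filterlim_at_bot_mono)
  show "filterlim (\<lambda>n. - (\<delta> / 2) * (1 + ln (real n)) - 2 * ln (\<delta> / 4)) at_bot sequentially"
    using \<delta> by real_asymp
  show "\<forall>\<^sub>F n in sequentially. fa_exponent n (k n) (\<tau> n) + 2 * ln (real (k n)) \<le>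
      - (\<delta> / 2) * (1 + ln (real n)) - 2 * ln (\<delta> / 4)"
    using k F
  proof eventually_elim
    case (elim n)
    let ?K = "real (k n)" and ?L = "log_ratio n (k n)"
    have K: "0 < k n" "k n \<le> n" using elim by auto
    \<comment> \<open>the tangent line bound, scaled so that \<open>2 ln k\<close> grows by only \<open>\<delta> k / 2\<close>\<close>
    have "ln (\<delta> / 4 * ?K) \<le> \<delta> / 4 * ?K - 1" using \<delta> K by (intro ln_le_minus_one) simp
    moreover have "ln (\<delta> / 4 * ?K) = ln (\<delta> / 4) + ln ?K" using \<delta> K by (intro ln_mult_pos) auto
    ultimately have 1: "2 * ln ?K \<le> \<delta> / 2 * ?K - 2 * ln (\<delta> / 4)" by simp
    have "?K * 1 \<le> ?K * ?L" using K by (intro mult_left_mono log_ratio_ge_1) auto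
    then have 2: "\<delta> / 2 * ?K \<le> \<delta> / 2 * (?K * ?L)" using \<delta> by (intro mult_left_mono) auto
    have 3: "\<delta> / 2 * (1 + ln (real n)) \<le> \<delta> / 2 * (?K * ?L)"
      using \<delta> K by (intro mult_left_mono mult_log_ratio_ge) auto
    show ?case using 1 2 3 elim(2) by linarith
  qed
qed

section \<open>Exponents in the parameter regimes\<close>

lemma pairs_minus_one_scaled:
  assumes "2 \<le> k"
  shows "(real (k choose 2) - 1) * (a / (real k - 1)) = a * real k / 2 - a / (real k - 1)"
  using assms unfolding real_choose_two by (simp add: field_simps)

lemma pairs_minus_one_nonneg: "2 \<le> k \<Longrightarrow> 0 \<le> real (k choose 2) - 1"
  using zero_less_binomial[of 2 k] by linarith

text \<open>
  All regimes but two bound \<open>ln \<tau>\<close> by a multiple of \<open>1 / (k - 1)\<close>. Summed over all edges but the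
  anchor, this becomes almost a multiple of \<open>k\<close>; the correction \<open>a / (k - 1)\<close> is the price of the
  anchored edge.
\<close>

lemma pairs_ln_le:
  assumes k: "2 \<le> k" and \<tau>: "ln \<tau> \<le> - (a / (real k - 1) * l)"
  shows "(real (k choose 2) - 1) * ln \<tau> \<le> - ((a * real k / 2 - a / (real k - 1)) * l)"
proof -
  have "(real (k choose 2) - 1) * ln \<tau> \<le> (real (k choose 2) - 1) * - (a / (real k - 1) * l)"
    by (intro mult_left_mono \<tau> pairs_minus_one_nonneg k)
  also have "\<dots> = - ((a * real k / 2 - a / (real k - 1)) * l)"
    unfolding pairs_minus_one_scaled[OF k, symmetric] by simp
  finally show ?thesis .
qed

text \<open>
  The condition \<open>k > 3 / \<epsilon>\<close> is what absorbs the anchored edge: it forces \<open>k \<ge> 4\<close>, so the loss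
  \<open>(2 + \<epsilon>) / (k - 1)\<close> is below \<open>1\<close>, while \<open>\<epsilon> k / 3\<close> exceeds \<open>1\<close>. Of the gain \<open>\<epsilon> k / 2\<close> there remains
  \<open>\<epsilon> k / 6\<close>.
\<close>

lemma pairs_gain:
  assumes \<epsilon>: "0 < \<epsilon>" "\<epsilon> < 1" and k: "3 / \<epsilon> < real k"
  shows "(1 + \<epsilon> / 6) * real k \<le> ((2 + \<epsilon>) * real k / 2 - (2 + \<epsilon>) / (real k - 1))"
proof -
  have ek: "3 < \<epsilon> * real k" using k \<epsilon> by (simp add: field_simps)
  also have "\<epsilon> * real k \<le> 1 * real k" using \<epsilon> by (intro mult_right_mono) auto
  finally have "4 \<le> real k" by simp
  then have "(2 + \<epsilon>) / (real k - 1) \<le> 1" using \<epsilon> by (simp add: field_simps)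
  moreover have "(1 + \<epsilon> / 6) * real k = (2 + \<epsilon>) * real k / 2 - \<epsilon> * real k / 3"
    by (simp add: algebra_simps)
  ultimately show ?thesis using ek by linarith
qed

lemma ln_inverse_ratio: "0 < k \<Longrightarrow> 0 < n \<Longrightarrow> ln (real k / (real n * exp 1)) = - log_ratio n k"
  by (simp add: log_ratio_eq ln_div ln_mult)

lemma fa_exponent_powr:
  assumes \<epsilon>: "0 < \<epsilon>" "\<epsilon> < 1" and k: "3 / \<epsilon> < real k" "2 \<le> k" "k \<le> n" and "0 < \<tau>"
    and \<tau>: "\<tau> \<le> (real k / (real n * exp 1)) powr ((2 + \<epsilon>) / (real k - 1))"
  shows "fa_exponent n k \<tau> \<le> - (\<epsilon> / 6) * (real k * log_ratio n k)"
proof -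
  have "ln \<tau> \<le> ln ((real k / (real n * exp 1)) powr ((2 + \<epsilon>) / (real k - 1)))"
    using \<tau> \<open>0 < \<tau>\<close> by (rule ln_mono)
  also have "\<dots> = - ((2 + \<epsilon>) / (real k - 1) * log_ratio n k)"
    using k by (simp add: ln_powr ln_inverse_ratio)
  finally have "(real (k choose 2) - 1) * ln \<tau> \<le>
      - (((2 + \<epsilon>) * real k / 2 - (2 + \<epsilon>) / (real k - 1)) * log_ratio n k)"
    by (rule pairs_ln_le[OF k(2)])
  moreover have "(1 + \<epsilon> / 6) * real k * log_ratio n k \<le>
      ((2 + \<epsilon>) * real k / 2 - (2 + \<epsilon>) / (real k - 1)) * log_ratio n k"
    using log_ratio_ge_1[of k n] k by (intro mult_right_mono pairs_gain \<epsilon>) auto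
  ultimately have "(real (k choose 2) - 1) * ln \<tau> \<le> - ((1 + \<epsilon> / 6) * real k * log_ratio n k)"
    by linarith
  then show ?thesis unfolding fa_exponent_def by (simp add: algebra_simps)
qed

text \<open>
  Here the exponent of \<open>\<tau>\<close> is driven by \<open>ln (n / k) = L - 1\<close> instead of \<open>L\<close>. The difference costs \<open>k\<close>,
  which is negligible against \<open>\<epsilon> k L\<close> once \<open>n / k\<close> is large; the threshold \<open>8 / \<epsilon> + 1\<close> spends \<open>\<epsilon> / 8\<close> of
  the available \<open>\<epsilon> / 6\<close> on it and keeps \<open>\<epsilon> / 24\<close>.
\<close>

lemma fa_exponent_sparse:
  assumes \<epsilon>: "0 < \<epsilon>" "\<epsilon> < 1" and k: "3 / \<epsilon> < real k" "2 \<le> k" "k \<le> n"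
    and sparse: "8 / \<epsilon> + 1 \<le> ln (real n / real k)"
    and \<tau>: "\<tau> = (real k / real n) powr ((2 + \<epsilon>) / (real k - 1))"
  shows "fa_exponent n k \<tau> \<le> - (\<epsilon> / 24) * (real k * log_ratio n k)"
proof -
  define l where "l = ln (real n / real k)"
  have ln_kn: "ln (real k / real n) = - l" using k unfolding l_def by (simp add: ln_div)
  have L: "log_ratio n k = 1 + l" using k unfolding l_def by (simp add: log_ratio_eq ln_div)
  have "8 + \<epsilon> \<le> \<epsilon> * l" using sparse \<epsilon> unfolding l_def[symmetric] by (simp add: field_simps)
  then have "real k * (24 + \<epsilon>) \<le> real k * (3 * (\<epsilon> * l))" using \<epsilon> by (intro mult_left_mono) auto
  then have 1: "real k + \<epsilon> / 24 * real k \<le> \<epsilon> / 8 * (real k * l)" by (simp add: algebra_simps)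
  have "8 / \<epsilon> > 0" using \<epsilon> by simp
  then have l0: "0 \<le> l" using sparse unfolding l_def by linarith
  have "ln \<tau> = - ((2 + \<epsilon>) / (real k - 1) * l)"
    unfolding \<tau> ln_powr ln_kn by simp
  then have "(real (k choose 2) - 1) * ln \<tau> \<le> - (((2 + \<epsilon>) * real k / 2 - (2 + \<epsilon>) / (real k - 1)) * l)"
    by (intro pairs_ln_le k) simp
  moreover have "(1 + \<epsilon> / 6) * real k * l \<le> ((2 + \<epsilon>) * real k / 2 - (2 + \<epsilon>) / (real k - 1)) * l"
    using l0 k by (intro mult_right_mono pairs_gain \<epsilon>) auto
  ultimately have "(real (k choose 2) - 1) * ln \<tau> \<le> - ((1 + \<epsilon> / 6) * real k * l)"
    by linarith
  then show ?thesis unfolding fa_exponent_def L using 1 by (simp add: algebra_simps add_divide_distrib)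
qed

text \<open>
  By \<open>ln \<tau> \<le> \<tau> - 1\<close>. For large \<open>k\<close> the loss \<open>2 (1 + \<epsilon>) / (k - 1) \<le> 2 (1 + \<epsilon>)\<close> from the anchored edge
  is at most half of the gain \<open>\<epsilon> k\<close>.
\<close>

lemma fa_exponent_near_one:
  assumes \<epsilon>: "0 < \<epsilon>" and k: "4 * (1 + \<epsilon>) / \<epsilon> \<le> real k" "2 \<le> k" "k \<le> n" and "0 < \<tau>"
    and \<tau>: "\<tau> \<le> 1 - 2 * (1 + \<epsilon>) / (real k - 1) * log_ratio n k"
  shows "fa_exponent n k \<tau> \<le> - (\<epsilon> / 2) * (real k * log_ratio n k)"
proof -
  have "ln \<tau> \<le> - (2 * (1 + \<epsilon>) / (real k - 1) * log_ratio n k)"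
    using ln_le_minus_one[OF \<open>0 < \<tau>\<close>] \<tau> by linarith
  then have 1: "(real (k choose 2) - 1) * ln \<tau> \<le>
      - ((2 * (1 + \<epsilon>) * real k / 2 - 2 * (1 + \<epsilon>) / (real k - 1)) * log_ratio n k)"
    by (rule pairs_ln_le[OF k(2)])
  have "2 * (1 + \<epsilon>) / (real k - 1) \<le> 2 * (1 + \<epsilon>) / 1"
    using k \<epsilon> by (intro divide_left_mono) auto
  also have "\<dots> \<le> \<epsilon> / 2 * real k" using k(1) \<epsilon> by (simp add: field_simps)
  finally have "2 * (1 + \<epsilon>) / (real k - 1) \<le> \<epsilon> / 2 * real k" .
  moreover have "(1 + \<epsilon> / 2) * real k = 2 * (1 + \<epsilon>) * real k / 2 - \<epsilon> / 2 * real k"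
    by (simp add: algebra_simps)
  ultimately have "(1 + \<epsilon> / 2) * real k \<le> 2 * (1 + \<epsilon>) * real k / 2 - 2 * (1 + \<epsilon>) / (real k - 1)"
    by linarith
  then have "(1 + \<epsilon> / 2) * real k * log_ratio n k \<le>
      (2 * (1 + \<epsilon>) * real k / 2 - 2 * (1 + \<epsilon>) / (real k - 1)) * log_ratio n k"
    using log_ratio_ge_1[of k n] k by (intro mult_right_mono) auto
  with 1 have "(real (k choose 2) - 1) * ln \<tau> \<le> - ((1 + \<epsilon> / 2) * real k * log_ratio n k)"
    by linarith
  then show ?thesis unfolding fa_exponent_def by (simp add: algebra_simps)
qed

text \<open>
  The power in \<open>\<tau>\<close> is normalised by the exact number \<open>m - 1\<close> of constrained edges, so no loss occurs.
  For \<open>k \<ge> 3\<close> this number is not zero.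
\<close>

lemma fa_exponent_exact:
  assumes k: "3 \<le> k" "k \<le> n"
    and \<tau>: "\<tau> = (real k / (real n * exp 1)) powr ((1 + \<epsilon>) * real k / (real (k choose 2) - 1))"
  shows "fa_exponent n k \<tau> = - \<epsilon> * (real k * log_ratio n k)"
proof -
  have "3 choose 2 \<le> k choose 2" using k by (intro binomial_right_mono)
  then have "real (k choose 2) - 1 \<noteq> 0" by (simp add: numeral_eq_Suc)
  then have "(real (k choose 2) - 1) * ln \<tau> = - ((1 + \<epsilon>) * real k * log_ratio n k)"
    unfolding \<tau> using k by (simp add: ln_powr ln_inverse_ratio)
  then show ?thesis unfolding fa_exponent_def by (simp add: algebra_simps)
qed

text \<open>
  With \<open>ln n \<le> (k + 1) / c\<close> the entropy \<open>k L\<close> is at most \<open>k\<^sup>2 / c - k ln k\<close> up to linear terms, and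
  \<open>(m - 1) ln \<tau> \<le> - k\<^sup>2 / c\<close> up to linear terms. The squares cancel, and \<open>k ln k\<close> dominates what is left.
\<close>

lemma fa_exponent_log_size:
  assumes c: "0 < c" and k: "2 \<le> k" "k \<le> n" "c * ln (real n) \<le> real k + 1"
    and \<tau>: "0 < \<tau>" "\<tau> \<le> exp (- 2 / c)"
  shows "fa_exponent n k \<tau> \<le> real k + (2 * real k + 2) / c - real k * ln (real k)"
proof -
  have "ln (real n) \<le> (real k + 1) / c" using c k(3) by (simp add: field_simps)
  then have "real k * log_ratio n k \<le> real k * (1 + (real k + 1) / c - ln (real k))"
    using k by (intro mult_left_mono) (auto simp: log_ratio_eq)
  moreover have "ln \<tau> \<le> - 2 / c" using \<tau> by (metis ln_exp ln_mono)
  then have "(real (k choose 2) - 1) * ln \<tau> \<le> (real (k choose 2) - 1) * (- 2 / c)"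
    by (intro mult_left_mono pairs_minus_one_nonneg k)
  moreover have "real k * (1 + (real k + 1) / c - ln (real k)) + (real (k choose 2) - 1) * (- 2 / c) =
      real k + (2 * real k + 2) / c - real k * ln (real k)"
    unfolding real_choose_two using c by (simp add: field_simps)
  ultimately show ?thesis unfolding fa_exponent_def by linarith
qed

section \<open>Strong detection\<close>

text \<open>
  Missed detections have probability zero, so only the false alarm bound has to tend to zero.
\<close>

lemma strong_detection_if_exponent_at_bot:
  assumes model: "\<forall>\<^sub>F n in sequentially. 2 \<le> k n \<and> k n \<le> n \<and> 0 < \<tau> n \<and> \<tau> n < 1"
    and F: "filterlim (\<lambda>n. fa_exponent n (k n) (\<tau> n) + 2 * ln (real (k n))) at_bot sequentially"
  shows "strong_detection k \<tau> (\<lambda>n. community_interval_test n (k n) (\<tau> n))"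
proof -
  have lim: "(\<lambda>n. exp (fa_exponent n (k n) (\<tau> n) + 2 * ln (real (k n)))) \<longlonglongrightarrow> 0"
    using exp_at_bot F by (rule filterlim_compose)
  have upper: "\<forall>\<^sub>F n in sequentially. p_fa n (community_interval_test n (k n) (\<tau> n)) \<le>
      exp (fa_exponent n (k n) (\<tau> n) + 2 * ln (real (k n)))"
    using model by eventually_elim (rule order_trans[OF p_fa_le union_bound_le_exp]; simp)
  have lower: "\<forall>\<^sub>F n in sequentially. 0 \<le> p_fa n (community_interval_test n (k n) (\<tau> n))"
    by (simp add: p_fa_def)
  have fa: "(\<lambda>n. p_fa n (community_interval_test n (k n) (\<tau> n))) \<longlonglongrightarrow> 0"
    by (rule tendsto_sandwich[OF lower upper tendsto_const lim])
  have "\<forall>\<^sub>F n in sequentially. p_miss n (k n) (\<tau> n) (community_interval_test n (k n) (\<tau> n)) = 0"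
    using model by eventually_elim (rule p_miss_zero; simp)
  then have "(\<lambda>n. p_miss n (k n) (\<tau> n) (community_interval_test n (k n) (\<tau> n))) \<longlonglongrightarrow> 0"
    by (rule tendsto_eventually)
  with fa show ?thesis
    unfolding strong_detection_def using is_test_community_interval by blast
qed

lemma strong_detection_if_exponent_le:
  assumes model: "\<forall>\<^sub>F n in sequentially. 2 \<le> k n \<and> k n \<le> n \<and> 0 < \<tau> n \<and> \<tau> n < 1"
    and "\<delta> > 0"
    and "\<forall>\<^sub>F n in sequentially. fa_exponent n (k n) (\<tau> n) \<le> - \<delta> * (real (k n) * log_ratio n (k n))"
  shows "strong_detection k \<tau> (\<lambda>n. community_interval_test n (k n) (\<tau> n))"
proof (rule strong_detection_if_exponent_at_bot[OF model filterlim_fa_exponent])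
  show "\<forall>\<^sub>F n in sequentially. 2 \<le> k n \<and> k n \<le> n"
    using model by eventually_elim simp
qed fact+

theorem corollary5:
  fixes k :: "nat \<Rightarrow> nat" and \<tau> :: "nat \<Rightarrow> real"
  assumes model: "\<forall>\<^sub>F n in sequentially. 2 \<le> k n \<and> k n \<le> n \<and> 0 < \<tau> n \<and> \<tau> n < 1"
  shows
    "(\<forall>c>0.
        (\<forall>\<^sub>F n in sequentially.
            \<bar>real (k n) - c * ln (real n)\<bar> < 1 \<and> \<tau> n \<le> exp (- 2 / c))
        \<longrightarrow> strong_detection k \<tau> (\<lambda>n. community_interval_test n (k n) (\<tau> n))) \<and>
     (\<forall>\<epsilon>. 0 < \<epsilon> \<and> \<epsilon> < 1 \<and>
        (\<forall>\<^sub>F n in sequentially.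
            3 / \<epsilon> < real (k n) \<and> k n \<le> n \<and>
            \<tau> n \<le> (real (k n) / (real n * exp 1)) powr ((2 + \<epsilon>) / (real (k n) - 1)))
        \<longrightarrow> strong_detection k \<tau> (\<lambda>n. community_interval_test n (k n) (\<tau> n))) \<and>
     (\<forall>\<epsilon>>0.
        filterlim (\<lambda>n. real (k n) / ln (real n)) at_top sequentially \<and>
        (\<forall>\<^sub>F n in sequentially.
            \<tau> n \<le> 1 - 2 * (1 + \<epsilon>) / (real (k n) - 1) * ln (real n * exp 1 / real (k n)))
        \<longrightarrow> strong_detection k \<tau> (\<lambda>n. community_interval_test n (k n) (\<tau> n))) \<and>
     (\<forall>\<epsilon>>0.
        (\<forall>\<^sub>F n in sequentially.
            3 \<le> k n \<and> k n \<le> n \<and>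
            \<tau> n = (real (k n) / (real n * exp 1))
                    powr ((1 + \<epsilon>) * real (k n) / (real (k n choose 2) - 1)))
        \<longrightarrow> strong_detection k \<tau> (\<lambda>n. community_interval_test n (k n) (\<tau> n))) \<and>
     (\<forall>\<epsilon>. 0 < \<epsilon> \<and> \<epsilon> < 1 \<and>
        (\<lambda>n. real (k n)) \<in> o(\<lambda>n. real n) \<and>
        (\<forall>\<^sub>F n in sequentially.
            3 / \<epsilon> < real (k n) \<and>
            \<tau> n = (real (k n) / real n) powr ((2 + \<epsilon>) / (real (k n) - 1)))
        \<longrightarrow> strong_detection k \<tau> (\<lambda>n. community_interval_test n (k n) (\<tau> n)))"
proof (intro conjI allI impI; (elim conjE)?)
  fix c :: real
  assume c: "0 < c"
    and H: "\<forall>\<^sub>F n in sequentially. \<bar>real (k n) - c * ln (real n)\<bar> < 1 \<and> \<tau> n \<le> exp (- 2 / c)"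
  let ?G = "\<lambda>x :: real. x + (2 * x + 2) / c - x * ln x + 2 * ln x"
  have "filterlim (\<lambda>n. real (k n)) at_top sequentially"
  proof (rule filterlim_at_top_mono)
    show "filterlim (\<lambda>n. c * ln (real n) - 1) at_top sequentially" using c by real_asymp
    show "\<forall>\<^sub>F n in sequentially. c * ln (real n) - 1 \<le> real (k n)"
      using H by eventually_elim linarith
  qed
  moreover have "filterlim ?G at_bot at_top" using c by real_asymp
  ultimately have G: "filterlim (\<lambda>n. ?G (real (k n))) at_bot sequentially"
    by (rule filterlim_compose[rotated])
  have "\<forall>\<^sub>F n in sequentially. fa_exponent n (k n) (\<tau> n) + 2 * ln (real (k n)) \<le> ?G (real (k n))"
    using model H
  proof eventually_elim
    case (elim n)
    then have "c * ln (real n) \<le> real (k n) + 1" by linarith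
    with elim show ?case using fa_exponent_log_size[OF c, of "k n" n "\<tau> n"] by simp
  qed
  then show "strong_detection k \<tau> (\<lambda>n. community_interval_test n (k n) (\<tau> n))"
    by (intro strong_detection_if_exponent_at_bot model filterlim_at_bot_mono[OF G])
next
  fix \<epsilon> :: real
  assume \<epsilon>: "0 < \<epsilon>" "\<epsilon> < 1"
    and H: "\<forall>\<^sub>F n in sequentially. 3 / \<epsilon> < real (k n) \<and> k n \<le> n \<and>
            \<tau> n \<le> (real (k n) / (real n * exp 1)) powr ((2 + \<epsilon>) / (real (k n) - 1))"
  show "strong_detection k \<tau> (\<lambda>n. community_interval_test n (k n) (\<tau> n))"
  proof (rule strong_detection_if_exponent_le[OF model])
    show "0 < \<epsilon> / 6" using \<epsilon> by simp
    show "\<forall>\<^sub>F n in sequentially. fa_exponent n (k n) (\<tau> n) \<le> - (\<epsilon> / 6) * (real (k n) * log_ratio n (k n))"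
      using model H by eventually_elim (rule fa_exponent_powr[OF \<epsilon>]; blast)
  qed
next
  fix \<epsilon> :: real
  assume \<epsilon>: "0 < \<epsilon>"
    and K: "filterlim (\<lambda>n. real (k n) / ln (real n)) at_top sequentially"
    and H: "\<forall>\<^sub>F n in sequentially.
            \<tau> n \<le> 1 - 2 * (1 + \<epsilon>) / (real (k n) - 1) * ln (real n * exp 1 / real (k n))"
  \<comment> \<open>\<open>k / ln n\<close> diverges and \<open>ln n \<ge> 1\<close> eventually, so \<open>k\<close> exceeds every constant\<close>
  define Z where "Z = 4 * (1 + \<epsilon>) / \<epsilon>"
  have "\<forall>\<^sub>F n in sequentially. 1 \<le> ln (real n)" by real_asymp
  moreover have "\<forall>\<^sub>F n in sequentially. Z \<le> real (k n) / ln (real n)"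
    using K by (simp add: filterlim_at_top)
  ultimately have Z: "\<forall>\<^sub>F n in sequentially. Z \<le> real (k n)"
  proof eventually_elim
    case (elim n)
    have "real (k n) / ln (real n) \<le> real (k n) / 1" using elim(1) by (intro divide_left_mono) auto
    with elim(2) show ?case by simp
  qed
  show "strong_detection k \<tau> (\<lambda>n. community_interval_test n (k n) (\<tau> n))"
  proof (rule strong_detection_if_exponent_le[OF model])
    show "0 < \<epsilon> / 2" using \<epsilon> by simp
    show "\<forall>\<^sub>F n in sequentially. fa_exponent n (k n) (\<tau> n) \<le> - (\<epsilon> / 2) * (real (k n) * log_ratio n (k n))"
      using model H Z unfolding Z_def log_ratio_def[symmetric]
      by eventually_elim (rule fa_exponent_near_one[OF \<epsilon>]; blast)
  qed
next
  fix \<epsilon> :: real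
  assume \<epsilon>: "0 < \<epsilon>"
    and H: "\<forall>\<^sub>F n in sequentially. 3 \<le> k n \<and> k n \<le> n \<and>
            \<tau> n = (real (k n) / (real n * exp 1))
                    powr ((1 + \<epsilon>) * real (k n) / (real (k n choose 2) - 1))"
  show "strong_detection k \<tau> (\<lambda>n. community_interval_test n (k n) (\<tau> n))"
  proof (rule strong_detection_if_exponent_le[OF model \<epsilon>])
    show "\<forall>\<^sub>F n in sequentially. fa_exponent n (k n) (\<tau> n) \<le> - \<epsilon> * (real (k n) * log_ratio n (k n))"
      using H by eventually_elim (rule eq_refl, rule fa_exponent_exact; blast)
  qed
next
  fix \<epsilon> :: real
  assume \<epsilon>: "0 < \<epsilon>" "\<epsilon> < 1"
    and o: "(\<lambda>n. real (k n)) \<in> o(\<lambda>n. real n)"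
    and H: "\<forall>\<^sub>F n in sequentially. 3 / \<epsilon> < real (k n) \<and>
            \<tau> n = (real (k n) / real n) powr ((2 + \<epsilon>) / (real (k n) - 1))"
  \<comment> \<open>the threshold for \<open>ln (n / k)\<close> that \<open>k = o(n)\<close> eventually exceeds\<close>
  define B where "B = 8 / \<epsilon> + 1"
  have "\<forall>\<^sub>F n in sequentially. norm (real (k n)) \<le> exp (- B) * norm (real n)"
    using o by (rule landau_o.smallD) simp
  then have sparse: "\<forall>\<^sub>F n in sequentially. B \<le> ln (real n / real (k n))"
    using model
  proof eventually_elim
    case (elim n)
    then have "exp B \<le> real n / real (k n)" by (simp add: field_simps exp_minus)
    with elim show ?case by (subst ln_ge_iff) auto
  qed
  show "strong_detection k \<tau> (\<lambda>n. community_interval_test n (k n) (\<tau> n))"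
  proof (rule strong_detection_if_exponent_le[OF model])
    show "0 < \<epsilon> / 24" using \<epsilon> by simp
    show "\<forall>\<^sub>F n in sequentially. fa_exponent n (k n) (\<tau> n) \<le> - (\<epsilon> / 24) * (real (k n) * log_ratio n (k n))"
      using model H sparse unfolding B_def
      by eventually_elim (rule fa_exponent_sparse[OF \<epsilon>]; blast)
  qed
qed

end
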